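(* Let $\mathcal{A}\in\mathcal{T}_{m,n}$ be a $Z$-tensor and let $b\in\mathbb{R}^n_+$. Consider the problems $$(P_0)\qquad \min\ \|x\|_0\quad\text{s.t.}\quad \mathcal{A}x^{m-1}-b\ge 0,\ x\ge 0,\ \langle x,\mathcal{A}x^{m-1}-b\rangle=0,$$ $$(P_1)\qquad \min\ e^{T}x\quad\text{s.t.}\quad \mathcal{A}x^{m-1}-b=0,\ x\ge 0,$$ over $x\in\mathbb{R}^n$. If the problem $(P_0)$ is feasible, then $(P_0)$ has an optimal solution $x^*$ which is also the unique optimal solution to the problem $(P_1)$.
   Context: $m\ge 2$, $n\ge 1$ are integers. $\mathcal{T}_{m,n}$ is the set of all real tensors $\mathcal{A}=(a_{i_1\ldots i_m})$ of order $m$ and dimension $n$ (each index ranges over $[n]=\{1,\ldots,n\}$). For $x\in\mathbb{R}^n$, $\mathcal{A}x^{m-1}\in\mathbb{R}^n$ is the vector with $(\mathcal{A}x^{m-1})_i=\sum_{i_2,\ldots,i_m=1}^n a_{ii_2\ldots i_m}x_{i_2}\cdots x_{i_m}$. $\mathcal{A}$ is a $Z$-tensor if all its off-diagonal entries are nonpositive, i.e. $a_{i_1\ldots i_m}\le 0$ whenever $i_1,\ldots,i_m$ are not all equal. $\mathbb{R}^n_+$ is the nonnegative orthant, vector inequalities are componentwise, $\langle\cdot,\cdot\rangle$ is the standard inner product, $\|x\|_0$ is the number of nonzero components of $x$, and $e$ is the all-ones vector. A problem is feasible if some $x\in\mathbb{R}^n$ satisfies all its constraints. *)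

theory Defs
  imports "HOL-Analysis.Analysis"
begin

text \<open>
  A real tensor of order m over the index set \<open>'n\<close> (dimension \<open>CARD('n)\<close>) is a function on
  multi-indices, represented as lists over \<open>'n\<close>. Only the values at lists of length m are
  entries of the tensor; its values at other lists are never used.
\<close>

type_synonym 'n tensor = "'n list \<Rightarrow> real"

text \<open>The vector \<open>A x^(m-1)\<close>; the list \<open>js\<close> collects the indices \<open>i_2, ..., i_m\<close>.\<close>

definition tensor_apply :: "nat \<Rightarrow> 'n::finite tensor \<Rightarrow> real ^ 'n \<Rightarrow> real ^ 'n" where
  "tensor_apply m A x =
     (\<chi> i. \<Sum>js | length js = m - 1. A (i # js) * prod_list (map (\<lambda>j. x $ j) js))"

definition Z_tensor :: "nat \<Rightarrow> 'n tensor \<Rightarrow> bool" where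
  "Z_tensor m A \<longleftrightarrow>
     (\<forall>idx. length idx = m \<and> \<not> (\<exists>i. idx = replicate m i) \<longrightarrow> A idx \<le> 0)"

definition l0_norm :: "real ^ 'n::finite \<Rightarrow> nat" where
  "l0_norm x = card {i. x $ i \<noteq> 0}"

text \<open>The order on \<open>real ^ 'n\<close> is the componentwise one.\<close>

definition P0_feasible :: "nat \<Rightarrow> 'n::finite tensor \<Rightarrow> real ^ 'n \<Rightarrow> real ^ 'n \<Rightarrow> bool" where
  "P0_feasible m A b x \<longleftrightarrow>
     0 \<le> tensor_apply m A x - b \<and> 0 \<le> x \<and> x \<bullet> (tensor_apply m A x - b) = 0"

definition P1_feasible :: "nat \<Rightarrow> 'n::finite tensor \<Rightarrow> real ^ 'n \<Rightarrow> real ^ 'n \<Rightarrow> bool" where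
  "P1_feasible m A b x \<longleftrightarrow> tensor_apply m A x - b = 0 \<and> 0 \<le> x"

definition P0_optimal :: "nat \<Rightarrow> 'n::finite tensor \<Rightarrow> real ^ 'n \<Rightarrow> real ^ 'n \<Rightarrow> bool" where
  "P0_optimal m A b = is_arg_min l0_norm (P0_feasible m A b)"

text \<open>\<open>vec 1\<close> is the all-ones vector.\<close>

definition P1_optimal :: "nat \<Rightarrow> 'n::finite tensor \<Rightarrow> real ^ 'n \<Rightarrow> real ^ 'n \<Rightarrow> bool" where
  "P1_optimal m A b = is_arg_min (\<lambda>x. vec 1 \<bullet> x) (P1_feasible m A b)"

end

(*
  On the set F of all x >= 0 with A x^(m-1) >= b, every off-diagonal term of a Z-tensor is
  antitone, so F is closed under componentwise minima and therefore has a least element x,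
  found by minimising the sum of the coordinates over a compact part of F. If row i were slack
  at x, then x_i > 0, and lowering x_i a little would stay in F; hence A x^(m-1) = b. Since F
  contains the feasible sets of both problems, x is the unique minimiser of (P1), and its
  support is contained in the support of every point feasible for (P0).
*)
theory Submission
  imports Defs
begin

lemma prod_list_map_mono:
  fixes f g :: "'a \<Rightarrow> real"
  assumes "\<And>j. 0 \<le> f j" and "\<And>j. f j \<le> g j"
  shows "prod_list (map f js) \<le> prod_list (map g js)"
proof (induction js)
  case (Cons j js)
  have "0 \<le> prod_list (map f js)"
    by (rule prod_list_nonneg) (auto simp: assms(1))
  with Cons show ?case
    using assms order_trans[OF assms] by (auto intro: mult_mono)
qed simp

lemma continuous_on_tensor_apply:
  fixes A :: "'n::finite tensor"
  shows "continuous_on S (tensor_apply m A)"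
proof -
  have "continuous_on S (\<lambda>x. prod_list (map (\<lambda>j. x $ j) js))"
    for js :: "'n list" and S :: "(real ^ 'n) set"
    by (induction js) (auto intro!: continuous_intros)
  then show ?thesis
    unfolding tensor_apply_def by (intro continuous_intros) auto
qed

lemma tensor_apply_zero:
  assumes "m \<ge> 2"
  shows "tensor_apply m A 0 = (0 :: real ^ 'n::finite)"
proof -
  \<comment> \<open>For \<open>m \<ge> 2\<close> each monomial has at least one factor; for
    \<open>m = 1\<close> it would be the empty product 1.\<close>
  have "prod_list (map (\<lambda>j. (0 :: real ^ 'n) $ j) js) = 0" if "length js = m - 1" for js
    using that assms by (cases js) auto
  then show ?thesis
    by (simp add: tensor_apply_def vec_eq_iff)
qed

text \<open>In row \<open>i\<close> only the diagonal coefficient can be positive, and its monomial,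
  a power of coordinate \<open>i\<close>, agrees at \<open>x\<close> and \<open>y\<close>. Every
  other coefficient is nonpositive and multiplies a monomial that is monotone on the nonnegative
  orthant.\<close>

lemma Z_tensor_apply_antimono:
  fixes A :: "'n::finite tensor"
  assumes Z: "Z_tensor m A" and "0 \<le> x" "x \<le> y" and eq: "x $ i = y $ i"
  shows "tensor_apply m A y $ i \<le> tensor_apply m A x $ i"
proof -
  have "A (i # js) * prod_list (map (\<lambda>j. y $ j) js) \<le> A (i # js) * prod_list (map (\<lambda>j. x $ j) js)"
    if len: "length js = m - 1" for js
  proof (cases "js = replicate (m - 1) i")
    case True
    then show ?thesis by (simp add: eq)
  next
    case False
    \<comment> \<open>Truncated subtraction: for \<open>m = 0\<close>, \<open>js\<close> would be
      empty and hence equal to \<open>replicate (m - 1) i\<close>.\<close>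
    with len have "m \<noteq> 0"
      by (cases m) auto
    with False have "\<not> (\<exists>k. i # js = replicate m k)"
      by (auto simp: Cons_replicate_eq)
    with Z len \<open>m \<noteq> 0\<close> have "A (i # js) \<le> 0"
      unfolding Z_tensor_def by auto
    moreover have "prod_list (map (\<lambda>j. x $ j) js) \<le> prod_list (map (\<lambda>j. y $ j) js)"
      using assms(2,3) by (intro prod_list_map_mono) (auto simp: less_eq_vec_def)
    ultimately show ?thesis by (rule mult_left_mono_neg[rotated])
  qed
  then show ?thesis
    unfolding tensor_apply_def by (auto intro!: sum_mono)
qed

definition superfeasible :: "nat \<Rightarrow> 'n::finite tensor \<Rightarrow> real ^ 'n \<Rightarrow> (real ^ 'n) set" where
  "superfeasible m A b = {x. 0 \<le> x \<and> b \<le> tensor_apply m A x}"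

lemma closed_superfeasible: "closed (superfeasible m A b)"
  unfolding superfeasible_def less_eq_vec_def
  by (intro closed_Collect_conj closed_Collect_all closed_Collect_le continuous_intros
      continuous_on_tensor_apply)

text \<open>In row \<open>i\<close> the minimum is compared with whichever of \<open>x\<close> and
  \<open>y\<close> is smaller at \<open>i\<close>: it lies below that vector and shares its
  coordinate \<open>i\<close>, so antimonotonicity applies.\<close>

lemma superfeasible_min:
  assumes "Z_tensor m A" and x: "x \<in> superfeasible m A b" and y: "y \<in> superfeasible m A b"
  shows "(\<chi> i. min (x $ i) (y $ i)) \<in> superfeasible m A b"
proof -
  let ?z = "\<chi> i. min (x $ i) (y $ i)"
  have z: "0 \<le> ?z" "?z \<le> x" "?z \<le> y"
    using x y by (auto simp: superfeasible_def less_eq_vec_def)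
  have "b $ i \<le> tensor_apply m A ?z $ i" for i
  proof (cases "x $ i \<le> y $ i")
    case True
    then have "tensor_apply m A x $ i \<le> tensor_apply m A ?z $ i"
      by (intro Z_tensor_apply_antimono assms(1) z) simp
    with x show ?thesis
      by (auto simp: superfeasible_def less_eq_vec_def intro: order_trans)
  next
    case False
    then have "tensor_apply m A y $ i \<le> tensor_apply m A ?z $ i"
      by (intro Z_tensor_apply_antimono assms(1) z) simp
    with y show ?thesis
      by (auto simp: superfeasible_def less_eq_vec_def intro: order_trans)
  qed
  with z show ?thesis
    by (simp add: superfeasible_def less_eq_vec_def)
qed

lemma vec_le_sum_imp_eq:
  fixes x y :: "real ^ 'n::finite"
  assumes "x \<le> y" and "vec 1 \<bullet> y \<le> vec 1 \<bullet> x"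
  shows "x = y"
proof -
  have "(\<Sum>i\<in>UNIV. y $ i - x $ i) = 0"
    using assms by (intro antisym sum_nonneg) (auto simp: inner_vec_def less_eq_vec_def sum_subtractf)
  then show ?thesis
    using assms(1) by (auto simp: sum_nonneg_eq_0_iff less_eq_vec_def vec_eq_iff)
qed

lemma superfeasible_least:
  assumes Z: "Z_tensor m A" and u: "u \<in> superfeasible m A b"
  obtains x where "x \<in> superfeasible m A b" and "\<And>y. y \<in> superfeasible m A b \<Longrightarrow> x \<le> y"
proof -
  \<comment> \<open>The box up to \<open>u\<close> provides compactness, and \<open>u\<close> itself
    shows that the intersection is nonempty.\<close>
  let ?K = "superfeasible m A b \<inter> cbox 0 u"
  have "u \<in> ?K"
    using u by (auto simp: superfeasible_def mem_box_cart less_eq_vec_def)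
  moreover have "compact ?K"
    by (intro closed_Int_compact closed_superfeasible compact_cbox)
  ultimately obtain x where x: "x \<in> ?K" and min: "\<And>y. y \<in> ?K \<Longrightarrow> vec 1 \<bullet> x \<le> vec 1 \<bullet> y"
    using continuous_attains_inf[of ?K "\<lambda>x. vec 1 \<bullet> x"] by (fastforce intro: continuous_intros)
  have "x \<le> y" if y: "y \<in> superfeasible m A b" for y
  proof -
    let ?z = "\<chi> i. min (x $ i) (y $ i)"
    have "?z \<in> superfeasible m A b"
      using superfeasible_min[OF Z _ y] x by blast
    then have "?z \<in> ?K"
      using x by (auto simp: superfeasible_def mem_box_cart less_eq_vec_def min_le_iff_disj)
    \<comment> \<open>\<open>?z\<close> lies below \<open>x\<close>, yet its coordinate sum is no
      smaller because \<open>x\<close> is a minimiser on \<open>?K\<close>.\<close>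
    then have "?z = x"
      by (intro vec_le_sum_imp_eq min) (simp_all add: less_eq_vec_def)
    then show ?thesis
      by (auto simp: vec_eq_iff less_eq_vec_def min_def split: if_splits)
  qed
  with x show ?thesis using that by blast
qed

lemma superfeasible_least_tight:
  fixes A :: "'n::finite tensor"
  assumes "m \<ge> 2" and Z: "Z_tensor m A" and "0 \<le> b"
    and x: "x \<in> superfeasible m A b"
    and least: "\<And>y. y \<in> superfeasible m A b \<Longrightarrow> x \<le> y"
  shows "tensor_apply m A x = b"
proof (rule ccontr)
  assume "tensor_apply m A x \<noteq> b"
  with x obtain i where slack: "b $ i < tensor_apply m A x $ i"
    unfolding superfeasible_def less_eq_vec_def vec_eq_iff
    by (auto simp: order.order_iff_strict) metis
  have x0: "0 \<le> x" using x by (simp add: superfeasible_def)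
  \<comment> \<open>Otherwise 0 and \<open>x\<close> agree at \<open>i\<close>, and antimonotonicity
    bounds row \<open>i\<close> at \<open>x\<close> by its value 0 at the origin, hence by
    \<open>b $ i\<close>, against the slack.\<close>
  have "x $ i \<noteq> 0"
  proof
    assume "x $ i = 0"
    then have "tensor_apply m A x $ i \<le> tensor_apply m A 0 $ i"
      by (intro Z_tensor_apply_antimono Z x0) simp_all
    with slack \<open>0 \<le> b\<close> tensor_apply_zero[OF \<open>m \<ge> 2\<close>, of A] show False
      by (simp add: less_eq_vec_def) (metis leD order_trans)
  qed
  with x0 have pos: "0 < x $ i"
    by (metis less_eq_vec_def order.not_eq_order_implies_strict zero_index)
  \<comment> \<open>Only coordinate \<open>i\<close> is lowered, by \<open>t\<close>. A small
    positive \<open>t\<close> keeps row \<open>i\<close> above \<open>b $ i\<close> by continuity,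
    and \<open>t < x $ i\<close> keeps the point nonnegative.\<close>
  let ?y = "\<lambda>t. x - t *\<^sub>R axis i 1"
  have "continuous_on UNIV (\<lambda>t. tensor_apply m A (?y t) $ i)"
    by (intro continuous_intros continuous_on_compose2[OF continuous_on_tensor_apply[of UNIV]]) auto
  then have "((\<lambda>t. tensor_apply m A (?y t) $ i) \<longlongrightarrow> tensor_apply m A (?y 0) $ i) (at_right 0)"
    by (meson UNIV_I continuous_on_def subset_UNIV tendsto_within_subset)
  then have "eventually (\<lambda>t. b $ i < tensor_apply m A (?y t) $ i) (at_right 0)"
    by (rule order_tendstoD) (simp add: slack)
  moreover have "eventually (\<lambda>t. t \<in> {0<..<x $ i}) (at_right 0)"
    by (rule eventually_at_right_real[OF pos])
  ultimately have "eventually (\<lambda>t. b $ i < tensor_apply m A (?y t) $ i \<and> t \<in> {0<..<x $ i}) (at_right 0)"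
    by (rule eventually_conj)
  then obtain t where row: "b $ i < tensor_apply m A (?y t) $ i" and t: "0 < t" "t < x $ i"
    by (auto dest!: eventually_happens' [rotated])
  have y: "0 \<le> ?y t" "?y t \<le> x"
    using t x0 by (auto simp: less_eq_vec_def axis_def)
  have "b $ j \<le> tensor_apply m A (?y t) $ j" for j
  proof (cases "j = i")
    case True
    with row show ?thesis by simp
  next
    case False
    \<comment> \<open>Coordinate \<open>j\<close> is unchanged, so lowering coordinate
      \<open>i\<close> can only raise row \<open>j\<close>.\<close>
    then have "tensor_apply m A x $ j \<le> tensor_apply m A (?y t) $ j"
      by (intro Z_tensor_apply_antimono Z y) (simp add: axis_def)
    with x show ?thesis
      by (auto simp: superfeasible_def less_eq_vec_def intro: order_trans)
  qed
  with y have "?y t \<in> superfeasible m A b"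
    by (simp add: superfeasible_def less_eq_vec_def)
  from least[OF this] have "x $ i \<le> ?y t $ i"
    unfolding less_eq_vec_def by blast
  with t show False by simp
qed

theorem theorem3:
  fixes m :: nat and A :: "'n::finite tensor" and b :: "real ^ 'n"
  assumes "m \<ge> 2"
    and "Z_tensor m A"
    and "0 \<le> b"
    and "\<exists>x. P0_feasible m A b x"
  shows "\<exists>x. P0_optimal m A b x \<and> P1_optimal m A b x \<and> (\<forall>y. P1_optimal m A b y \<longrightarrow> y = x)"
proof -
  have P0: "y \<in> superfeasible m A b" if "P0_feasible m A b y" for y
    using that by (simp add: P0_feasible_def superfeasible_def less_eq_vec_def)
  have P1: "y \<in> superfeasible m A b" if "P1_feasible m A b y" for y
    using that by (simp add: P1_feasible_def superfeasible_def)
  from assms(4) P0 obtain u where "u \<in> superfeasible m A b" by blast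
  then obtain x where x: "x \<in> superfeasible m A b"
    and least: "\<And>y. y \<in> superfeasible m A b \<Longrightarrow> x \<le> y"
    using superfeasible_least[OF assms(2)] by blast
  have Ax: "tensor_apply m A x = b"
    by (rule superfeasible_least_tight[OF assms(1-3) x least])
  have x0: "0 \<le> x" using x by (simp add: superfeasible_def)
  have "l0_norm x \<le> l0_norm y" if "P0_feasible m A b y" for y
    unfolding l0_norm_def
  proof (rule card_mono)
    \<comment> \<open>From \<open>0 \<le> x \<le> y\<close>, a zero coordinate of \<open>y\<close>
      is also zero in \<open>x\<close>.\<close>
    show "{i. x $ i \<noteq> 0} \<subseteq> {i. y $ i \<noteq> 0}"
      using least[OF P0[OF that]] x0 by (auto simp: less_eq_vec_def) (metis order_antisym)
  qed simp
  moreover have "P0_feasible m A b x"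
    using x0 by (simp add: P0_feasible_def Ax)
  ultimately have opt0: "P0_optimal m A b x"
    by (auto simp: P0_optimal_def is_arg_min_linorder)
  have feas1: "P1_feasible m A b x"
    using x0 by (simp add: P1_feasible_def Ax)
  have "vec 1 \<bullet> x \<le> vec 1 \<bullet> y" if "P1_feasible m A b y" for y
    using least[OF P1[OF that]] by (auto simp: inner_vec_def less_eq_vec_def intro: sum_mono)
  with feas1 have opt1: "P1_optimal m A b x"
    by (auto simp: P1_optimal_def is_arg_min_linorder)
  have "y = x" if "P1_optimal m A b y" for y
  proof -
    \<comment> \<open>Optimality of \<open>y\<close> bounds its sum by that of \<open>x\<close>,
      while leastness gives \<open>x \<le> y\<close>; together they force equality.\<close>
    from that feas1 have "P1_feasible m A b y" "vec 1 \<bullet> y \<le> vec 1 \<bullet> x"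
      by (auto simp: P1_optimal_def is_arg_min_linorder)
    with vec_le_sum_imp_eq[OF least[OF P1]] show ?thesis by blast
  qed
  with opt0 opt1 show ?thesis by blast
qed

end
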